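(* Let $X\subseteq\mathbb{R}^n$ be a non-empty compact set, $\Theta\subseteq\mathbb{R}^n$ a closed convex set, $\hat c\in\Theta$, $\hat x\in\arg\max_{x'\in X}\langle\hat c,x'\rangle$, $x\in X$, and $g=\hat x-x$. For any $c^*\in\mathbb{R}^n$, $\langle g,\hat c-c^*\rangle$ is the linearized regret of $L_X(\hat c;x)-L_X(c^*;x)$ (i.e., $g\in\partial L_X(\hat c;x)$, the subdifferential of $L_X(\cdot;x)$ at $\hat c$), and it satisfies $$L_X(\hat c;x)-L_X(c^*;x)\le\langle g,\hat c-c^*\rangle=\ell^{\mathrm{sub}}(\hat c)+\ell^{\mathrm{est}}(\hat c),$$ where $\ell^{\mathrm{sub}}(\hat c)=\langle\hat c,\hat x-x\rangle$ and $\ell^{\mathrm{est}}(\hat c)=\langle c^*,x-\hat x\rangle$.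
   Context: $\langle\cdot,\cdot\rangle$ is the standard inner product on $\mathbb{R}^n$. $L_X(\cdot;x)$ is the Fenchel--Young loss with $\Omega=I_X$: $L_X(c;x)=\Omega^*(c)+\Omega(x)-\langle c,x\rangle$, where $I_X$ is the indicator function of $X$ ($0$ on $X$, $+\infty$ elsewhere) and $\Omega^*(c)=\sup_{x'\in\mathbb{R}^n}\left(\langle c,x'\rangle-\Omega(x')\right)$ is the convex conjugate. For a convex loss $f$, a prediction $\hat c$, a subgradient $g\in\partial f(\hat c)$ and a comparator $c^*$, the quantity $\langle g,\hat c-c^*\rangle$ is called the linearized regret of $f(\hat c)-f(c^* )$. *)

theory Defs
  imports "HOL-Analysis.Analysis"
begin

definition indicator_fun :: "'a set \<Rightarrow> 'a \<Rightarrow> ereal" where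
  "indicator_fun X x = (if x \<in> X then 0 else \<infinity>)"

definition convex_conjugate :: "('a::real_inner \<Rightarrow> ereal) \<Rightarrow> 'a \<Rightarrow> ereal" where
  "convex_conjugate \<Omega> c = (SUP x'. ereal (c \<bullet> x') - \<Omega> x')"

text \<open>On \<^typ>\<open>ereal\<close>, \<open>\<infinity> - \<infinity>\<close> and \<open>- \<infinity> + \<infinity>\<close> are both \<open>\<infinity>\<close>. Neither form
  occurs in the conjugate or in the loss below when \<open>\<Omega>\<close> is the indicator function of a
  non-empty set.\<close>

definition fenchel_young_loss :: "('a::real_inner \<Rightarrow> ereal) \<Rightarrow> 'a \<Rightarrow> 'a \<Rightarrow> ereal" where
  "fenchel_young_loss \<Omega> c x = convex_conjugate \<Omega> c + \<Omega> x - ereal (c \<bullet> x)"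

abbreviation FY_loss_set :: "'a::real_inner set \<Rightarrow> 'a \<Rightarrow> 'a \<Rightarrow> ereal" where
  "FY_loss_set X \<equiv> fenchel_young_loss (indicator_fun X)"

text \<open>Convexity of an extended-real-valued function means convexity of its epigraph; the
  library's \<^const>\<open>convex_on\<close> and \<^const>\<open>epigraph\<close> only cover real-valued functions.\<close>

definition convex_ereal :: "('a::real_vector \<Rightarrow> ereal) \<Rightarrow> bool" where
  "convex_ereal f \<longleftrightarrow> convex {(c, r :: real). f c \<le> ereal r}"

text \<open>The subdifferential is empty at points where the function is not finite.\<close>

definition subdifferential :: "('a::real_inner \<Rightarrow> ereal) \<Rightarrow> 'a \<Rightarrow> 'a set" where
  "subdifferential f c =
     {g. \<bar>f c\<bar> \<noteq> \<infinity> \<and> (\<forall>c'. f c + ereal (g \<bullet> (c' - c)) \<le> f c')}"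

text \<open>\<open>r\<close> is the linearized regret of \<open>f c - f cs\<close> with respect to \<open>g\<close>. The notion
  presupposes that \<open>f\<close> is convex and that \<open>g\<close> is a subgradient at the prediction \<open>c\<close>.\<close>

definition is_linearized_regret ::
  "('a::real_inner \<Rightarrow> ereal) \<Rightarrow> 'a \<Rightarrow> 'a \<Rightarrow> 'a \<Rightarrow> real \<Rightarrow> bool" where
  "is_linearized_regret f c cs g r \<longleftrightarrow>
     convex_ereal f \<and> g \<in> subdifferential f c \<and> r = g \<bullet> (c - cs)"

text \<open>In both losses \<open>xh\<close> stands for a maximizer of \<open>x' \<mapsto> \<langle>c, x'\<rangle>\<close> over the feasible set
  at the prediction \<open>c\<close>; the estimation loss depends on \<open>c\<close> only through \<open>xh\<close>.\<close>

definition suboptimality_loss :: "'a::real_inner \<Rightarrow> 'a \<Rightarrow> 'a \<Rightarrow> real" where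
  "suboptimality_loss c xh x = c \<bullet> (xh - x)"

definition estimate_loss :: "'a::real_inner \<Rightarrow> 'a \<Rightarrow> 'a \<Rightarrow> real" where
  "estimate_loss cs xh x = cs \<bullet> (x - xh)"

end

theory Submission
  imports Defs
begin

text \<open>For \<open>x \<in> X\<close> the loss is the support function of X shifted by x: its
  value at c is the supremum over x' in X of \<open>c \<bullet> (x' - x)\<close>. As a supremum of
  linear functions of c it is convex, and the linear function belonging to a maximizer
  \<open>xhat\<close> lies below the loss everywhere and touches it at the prediction. So
  \<open>xhat - x\<close> is a subgradient there, and the regret bound compares the two at
  \<open>cstar\<close>. The splitting into two losses is bilinearity.
  \<open>FY_loss_set_le_iff\<close> carries the argument: it replaces the extended-real supremum by
  a family of real inequalities.\<close>

lemma FY_loss_set_le_iff: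
  assumes "x \<in> X"
  shows "FY_loss_set X c x \<le> ereal r \<longleftrightarrow> (\<forall>x'\<in>X. c \<bullet> (x' - x) \<le> r)"
proof -
  have "FY_loss_set X c x \<le> ereal r \<longleftrightarrow> convex_conjugate (indicator_fun X) c \<le> ereal (r + c \<bullet> x)"
    using assms by (simp add: fenchel_young_loss_def indicator_fun_def ereal_minus_le_iff add.commute)
  also have "\<dots> \<longleftrightarrow> (\<forall>x'. ereal (c \<bullet> x') - indicator_fun X x' \<le> ereal (r + c \<bullet> x))"
    by (simp add: convex_conjugate_def SUP_le_iff)
  \<comment> \<open>Off X the term is \<open>-\<infinity>\<close> and imposes no constraint.\<close>
  also have "\<dots> \<longleftrightarrow> (\<forall>x'\<in>X. c \<bullet> (x' - x) \<le> r)"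
    by (simp add: indicator_fun_def inner_diff_right diff_le_eq Ball_def)
  finally show ?thesis .
qed

lemma FY_loss_set_ge:
  assumes "x \<in> X" "x' \<in> X"
  shows "ereal (c \<bullet> (x' - x)) \<le> FY_loss_set X c x"
  \<comment> \<open>It suffices to compare with every real upper bound of the loss.\<close>
  by (rule ereal_le_real) (use assms in \<open>simp add: FY_loss_set_le_iff\<close>)

lemma FY_loss_set_arg_max:
  assumes "x \<in> X" "is_arg_max (\<lambda>x'. c \<bullet> x') (\<lambda>x'. x' \<in> X) xhat"
  shows "FY_loss_set X c x = ereal (c \<bullet> (xhat - x))"
proof (rule antisym)
  show "FY_loss_set X c x \<le> ereal (c \<bullet> (xhat - x))"
    using assms by (auto simp: FY_loss_set_le_iff is_arg_max_linorder inner_diff_right)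
  show "ereal (c \<bullet> (xhat - x)) \<le> FY_loss_set X c x"
    using assms by (intro FY_loss_set_ge) (auto simp: is_arg_max_linorder)
qed

lemma convex_FY_loss_set:
  assumes "x \<in> X"
  shows "convex_ereal (\<lambda>c. FY_loss_set X c x)"
proof -
  \<comment> \<open>The epigraph is an intersection of half-spaces, one per x', since
    \<open>(x' - x, -1) \<bullet> (c, r) \<le> 0\<close> says
    \<open>c \<bullet> (x' - x) \<le> r\<close>.\<close>
  have "{(c, r). FY_loss_set X c x \<le> ereal r} =
      (\<Inter>x'\<in>X. {p. (x' - x, - 1) \<bullet> p \<le> 0})"
    by (auto simp: FY_loss_set_le_iff[OF assms] inner_commute)
  then show ?thesis
    by (simp add: convex_ereal_def convex_INT convex_halfspace_le)
qed

text \<open>The linear function with slope \<open>xhat - x\<close> minorizes the loss and agrees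
  with it at c, where the loss is therefore also finite.\<close>

lemma arg_max_subgradient_FY_loss_set:
  assumes "x \<in> X" "is_arg_max (\<lambda>x'. c \<bullet> x') (\<lambda>x'. x' \<in> X) xhat"
  shows "xhat - x \<in> subdifferential (\<lambda>c. FY_loss_set X c x) c"
proof -
  have "FY_loss_set X c x + ereal ((xhat - x) \<bullet> (c' - c)) \<le> FY_loss_set X c' x" for c'
    using FY_loss_set_ge[OF assms(1), of xhat c'] assms(2)
    by (simp add: FY_loss_set_arg_max[OF assms] is_arg_max_linorder
        inner_diff_right inner_commute)
  then show ?thesis
    by (simp add: subdifferential_def FY_loss_set_arg_max[OF assms])
qed

theorem proposition3p3:
  fixes X \<Theta> :: "(real ^ 'n) set"
    and chat xhat x g cstar :: "real ^ 'n"
  assumes "X \<noteq> {}" and "compact X"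
    and "closed \<Theta>" and "convex \<Theta>"
    and "chat \<in> \<Theta>"
    and "is_arg_max (\<lambda>x'. chat \<bullet> x') (\<lambda>x'. x' \<in> X) xhat"
    and "x \<in> X"
    and "g = xhat - x"
  shows "is_linearized_regret (\<lambda>c. FY_loss_set X c x) chat cstar g (g \<bullet> (chat - cstar))
    \<and> FY_loss_set X chat x - FY_loss_set X cstar x \<le> ereal (g \<bullet> (chat - cstar))
    \<and> g \<bullet> (chat - cstar) = suboptimality_loss chat xhat x + estimate_loss cstar xhat x"
proof (intro conjI)
  show "is_linearized_regret (\<lambda>c. FY_loss_set X c x) chat cstar g (g \<bullet> (chat - cstar))"
    using assms by (simp add: is_linearized_regret_def convex_FY_loss_set
        arg_max_subgradient_FY_loss_set)
  have "ereal (cstar \<bullet> g) \<le> FY_loss_set X cstar x"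
    using assms by (auto simp: is_arg_max_linorder intro!: FY_loss_set_ge)
  \<comment> \<open>At \<open>chat\<close> the linear function with slope g equals the loss; at
    \<open>cstar\<close> it only bounds the loss from below, which is the right direction under
    subtraction.\<close>
  then have "FY_loss_set X chat x - FY_loss_set X cstar x \<le> ereal (chat \<bullet> g) - ereal (cstar \<bullet> g)"
    using assms by (intro ereal_minus_mono) (auto simp: FY_loss_set_arg_max)
  also have "\<dots> = ereal (g \<bullet> (chat - cstar))"
    by (simp add: inner_diff_right inner_commute)
  finally show "FY_loss_set X chat x - FY_loss_set X cstar x \<le> ereal (g \<bullet> (chat - cstar))" .
  show "g \<bullet> (chat - cstar) = suboptimality_loss chat xhat x + estimate_loss cstar xhat x"
    using assms by (simp add: suboptimality_loss_def estimate_loss_def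
        inner_diff_right inner_diff_left inner_commute)
qed

end
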